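(* Let $G$ be a graph of order $n$ such that $G$ is not isomorphic to $K_3 \cup (n-3)K_1$ (when $n \geq 3$) and $G$ is not isomorphic to $K_3 \cup K_2 \cup (n-5)K_1$ (when $n \geq 5$). Then the maximum number of pairwise edge-disjoint edge-pairs in $G$ equals $\left\lfloor \frac{|E(G)|}{2} \right\rfloor$ if $|E(G)| \geq 2\Delta(G)$, and equals $|E(G)|-\Delta(G)$ if $|E(G)| < 2\Delta(G)$.
   Context: All graphs are finite, simple and undirected. $\Delta(G)$ denotes the maximum degree of $G$. An edge-pair is a set of two independent edges, i.e., two edges sharing no common vertex. Edge-pairs are edge-disjoint if, as sets of edges, they are pairwise disjoint. $K_m$ is the complete graph of order $m$, $G_1 \cup G_2$ is the vertex-disjoint union of graphs, and $mK_1$ is the edgeless graph on $m$ vertices. *)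

theory Defs
  imports Main
begin

record 'a ugraph =
  verts :: "'a set"
  edges :: "'a set set"

definition simple_graph :: "'a ugraph \<Rightarrow> bool" where
  "simple_graph G \<longleftrightarrow>
     finite (verts G) \<and> (\<forall>e\<in>edges G. e \<subseteq> verts G \<and> card e = 2)"

definition order :: "'a ugraph \<Rightarrow> nat" where
  "order G = card (verts G)"

definition degree :: "'a ugraph \<Rightarrow> 'a \<Rightarrow> nat" where
  "degree G v = card {e \<in> edges G. v \<in> e}"

(* On nat, a finite nonempty supremum is the maximum and the empty supremum is 0,
   so the graph without vertices gets maximum degree 0. *)
definition max_degree :: "'a ugraph \<Rightarrow> nat" where
  "max_degree G = (SUP v\<in>verts G. degree G v)"

definition graph_iso :: "'a ugraph \<Rightarrow> 'b ugraph \<Rightarrow> bool" where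
  "graph_iso G H \<longleftrightarrow>
     (\<exists>f. bij_betw f (verts G) (verts H) \<and>
          (\<forall>u\<in>verts G. \<forall>v\<in>verts G. {u, v} \<in> edges G \<longleftrightarrow> {f u, f v} \<in> edges H))"

definition complete_graph :: "nat \<Rightarrow> nat ugraph" where
  "complete_graph m =
     \<lparr>verts = {..<m}, edges = {e. e \<subseteq> {..<m} \<and> card e = 2}\<rparr>"

definition edgeless_graph :: "nat \<Rightarrow> nat ugraph" where
  "edgeless_graph m = \<lparr>verts = {..<m}, edges = {}\<rparr>"

definition disjoint_union :: "'a ugraph \<Rightarrow> 'b ugraph \<Rightarrow> ('a + 'b) ugraph" where
  "disjoint_union G H =
     \<lparr>verts = verts G <+> verts H,
      edges = (\<lambda>e. Inl ` e) ` edges G \<union> (\<lambda>e. Inr ` e) ` edges H\<rparr>"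

definition edge_pairs :: "'a ugraph \<Rightarrow> 'a set set set" where
  "edge_pairs G =
     {{e, f} | e f. e \<in> edges G \<and> f \<in> edges G \<and> e \<noteq> f \<and> e \<inter> f = {}}"

definition edge_disjoint_families :: "'a ugraph \<Rightarrow> 'a set set set set" where
  "edge_disjoint_families G = {F. F \<subseteq> edge_pairs G \<and> pairwise disjnt F}"

definition max_edge_disjoint_pairs :: "'a ugraph \<Rightarrow> nat" where
  "max_edge_disjoint_pairs G = Max (card ` edge_disjoint_families G)"

lemma max_degree_eq_Max:
  assumes "verts G \<noteq> {}"
  shows "max_degree G = Max (degree G ` verts G)"
  using assms by (simp add: max_degree_def Sup_nat_def)

lemma finite_edges:
  assumes "simple_graph G"
  shows "finite (edges G)"
proof (rule finite_subset)
  show "edges G \<subseteq> Pow (verts G)"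
    using assms by (auto simp: simple_graph_def)
  show "finite (Pow (verts G))"
    using assms by (simp add: simple_graph_def)
qed

(* The following two facts make the Max in max_edge_disjoint_pairs a genuine maximum. *)
lemma finite_edge_disjoint_families:
  assumes "simple_graph G"
  shows "finite (edge_disjoint_families G)"
proof (rule finite_subset)
  show "edge_disjoint_families G \<subseteq> Pow (Pow (edges G))"
    unfolding edge_disjoint_families_def edge_pairs_def by blast
  show "finite (Pow (Pow (edges G)))"
    using finite_edges[OF assms] by simp
qed

lemma empty_in_edge_disjoint_families: "{} \<in> edge_disjoint_families G"
  by (simp add: edge_disjoint_families_def)

end

theory Submission
  imports Defs
begin

text \<open>
  Each edge-pair uses two edges, and at least one of them avoids a given vertex \<open>v\<close>; this gives the
  upper bounds \<open>|E| div 2\<close> and \<open>|E| - \<Delta>\<close>.  For the lower bound take a family \<open>F\<close> of maximum size and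
  let \<open>U\<close> be the set of edges it leaves uncovered.  The edges in \<open>U\<close> pairwise intersect, so if there
  are at least two of them, they form a star or a triangle.  By maximality, no \<open>{e, f} \<in> F\<close> can be
  exchanged for \<open>{a, e}, {b, f}\<close> with distinct \<open>a, b \<in> U\<close>.  If \<open>U\<close> is a triangle, this forces
  \<open>F = {}\<close>, so \<open>G\<close> is \<open>K\<^sub>3\<close> plus isolated vertices.  If \<open>U\<close> is a star at \<open>v\<close>, it forces every pair of
  \<open>F\<close> to meet \<open>v\<close>, and then \<open>|F| = |E| - deg v\<close>, unless \<open>U = {vx, vy}\<close> and some pair of \<open>F\<close> is
  \<open>{xy, f}\<close>.  In that case the three edges of the triangle \<open>vxy\<close> play symmetric roles, so every other
  pair of \<open>F\<close> would have to meet all of \<open>v, x, y\<close> without using an edge of the triangle, which is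
  impossible; hence \<open>G\<close> is \<open>K\<^sub>3 \<union> K\<^sub>2\<close> plus isolated vertices.
\<close>

section \<open>Edges and edge-pairs of simple graphs\<close>

lemma edge_pairsE:
  assumes "p \<in> edge_pairs G"
  obtains e f where "p = {e, f}" "e \<in> edges G" "f \<in> edges G" "e \<noteq> f" "e \<inter> f = {}"
  using assms by (auto simp: edge_pairs_def)

lemma edge_pairsI:
  assumes "e \<in> edges G" "f \<in> edges G" "e \<noteq> f" "e \<inter> f = {}"
  shows "{e, f} \<in> edge_pairs G"
  using assms by (auto simp: edge_pairs_def)

lemma simple_graph_edgeE:
  assumes "simple_graph G" "e \<in> edges G"
  obtains u v where "e = {u, v}" "u \<noteq> v" "u \<in> verts G" "v \<in> verts G"
proof -
  have "card e = 2" "e \<subseteq> verts G"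
    using assms by (auto simp: simple_graph_def)
  then show ?thesis
    using that by (auto simp: card_2_iff)
qed

lemma edge_eq_doubleton:
  assumes "simple_graph G" "e \<in> edges G" "{u, v} \<subseteq> e" "u \<noteq> v"
  shows "e = {u, v}"
proof -
  have "card e = 2"
    using assms(1,2) by (auto simp: simple_graph_def)
  then show ?thesis
    using card_subset_eq[of e "{u, v}"] assms(3,4) card.infinite[of e] by fastforce
qed

lemma edge_not_empty: "simple_graph G \<Longrightarrow> {} \<notin> edges G"
  by (auto simp: simple_graph_def)

lemma card_edges_split:
  assumes "simple_graph G"
  shows "card (edges G) = degree G v + card {e \<in> edges G. v \<notin> e}"
proof -
  have "edges G = {e \<in> edges G. v \<in> e} \<union> {e \<in> edges G. v \<notin> e}" by blast
  then have "card (edges G) = card ({e \<in> edges G. v \<in> e} \<union> {e \<in> edges G. v \<notin> e})" by simp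
  also have "\<dots> = card {e \<in> edges G. v \<in> e} + card {e \<in> edges G. v \<notin> e}"
    by (rule card_Un_disjoint) (use finite_edges[OF assms] in auto)
  finally show ?thesis by (simp add: degree_def)
qed

section \<open>Upper bounds for edge-disjoint families, and the maximum degree\<close>

lemma finite_edge_disjoint_family:
  assumes "simple_graph G" "F \<in> edge_disjoint_families G"
  shows "finite F"
proof (rule finite_subset)
  show "F \<subseteq> Pow (edges G)"
    using assms(2) by (auto simp: edge_disjoint_families_def edge_pairs_def)
  show "finite (Pow (edges G))"
    using finite_edges[OF assms(1)] by simp
qed

lemma card_Union_edge_disjoint_family:
  assumes "simple_graph G" "F \<in> edge_disjoint_families G"
  shows "card (\<Union>F) = 2 * card F"
proof -
  have pairs: "card p = 2" "finite p" if "p \<in> F" for p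
  proof -
    have "p \<in> edge_pairs G"
      using that assms(2) by (auto simp: edge_disjoint_families_def)
    then show "card p = 2" "finite p"
      by (elim edge_pairsE; simp)+
  qed
  have "card (\<Union>F) = sum card F"
    using assms(2) pairs by (intro card_Union_disjoint) (auto simp: edge_disjoint_families_def)
  also have "\<dots> = 2 * card F"
    using pairs by simp
  finally show ?thesis .
qed

lemma card_edge_disjoint_family_le_half:
  assumes "simple_graph G" "F \<in> edge_disjoint_families G"
  shows "2 * card F \<le> card (edges G)"
proof -
  have "\<Union>F \<subseteq> edges G"
    using assms(2) by (auto simp: edge_disjoint_families_def edge_pairs_def)
  then show ?thesis
    using card_mono[OF finite_edges[OF assms(1)]] card_Union_edge_disjoint_family[OF assms] by metis
qed

text \<open>The two edges of a pair are disjoint, so one of them avoids \<open>v\<close>. Choosing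
  such an edge from each pair is injective because distinct pairs of \<open>F\<close> share no
  edge.\<close>

lemma card_edge_disjoint_family_le_avoiding:
  assumes "simple_graph G" "F \<in> edge_disjoint_families G"
  shows "card F \<le> card {e \<in> edges G. v \<notin> e}"
proof -
  have "\<exists>e. e \<in> p \<and> e \<in> edges G \<and> v \<notin> e" if "p \<in> F" for p
  proof -
    have "p \<in> edge_pairs G"
      using that assms(2) by (auto simp: edge_disjoint_families_def)
    then show ?thesis
      by (elim edge_pairsE) blast
  qed
  then obtain c where c: "\<And>p. p \<in> F \<Longrightarrow> c p \<in> p \<and> c p \<in> edges G \<and> v \<notin> c p"
    by metis
  have "inj_on c F"
  proof (rule inj_onI)
    fix p q
    assume pq: "p \<in> F" "q \<in> F" "c p = c q"
    then have "\<not> disjnt p q"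
      using c[of p] c[of q] by (auto simp: disjnt_iff)
    then show "p = q"
      using assms(2) pq by (auto simp: edge_disjoint_families_def pairwise_def)
  qed
  then show ?thesis
    using c finite_edges[OF assms(1)] by (intro card_inj_on_le[of c]) auto
qed

lemma max_degree_attained:
  assumes "simple_graph G" "verts G \<noteq> {}"
  obtains v where "v \<in> verts G" "max_degree G = degree G v"
proof -
  have "Max (degree G ` verts G) \<in> degree G ` verts G"
    using assms by (intro Max_in) (auto simp: simple_graph_def)
  then show ?thesis
    using that assms(2) by (auto simp: max_degree_eq_Max)
qed

lemma degree_le_max_degree:
  assumes "simple_graph G" "v \<in> verts G"
  shows "degree G v \<le> max_degree G"
proof -
  have "verts G \<noteq> {}" "finite (verts G)"
    using assms by (auto simp: simple_graph_def)
  then show ?thesis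
    using assms(2) by (simp add: max_degree_eq_Max)
qed

section \<open>Exchange arguments in a maximum family\<close>

locale maximum_family =
  fixes G :: "'a ugraph" and F :: "'a set set set"
  assumes simple: "simple_graph G"
    and family: "F \<in> edge_disjoint_families G"
    and maximum: "F' \<in> edge_disjoint_families G \<Longrightarrow> card F' \<le> card F"
begin

abbreviation uncovered :: "'a set set" where
  "uncovered \<equiv> edges G - \<Union>F"

lemma finite_family: "finite F"
  using finite_edge_disjoint_family[OF simple family] .

lemma family_pair: "p \<in> F \<Longrightarrow> p \<in> edge_pairs G"
  using family by (auto simp: edge_disjoint_families_def)

lemma family_unique: "p \<in> F \<Longrightarrow> q \<in> F \<Longrightarrow> e \<in> p \<Longrightarrow> e \<in> q \<Longrightarrow> p = q"
  using family by (auto simp: edge_disjoint_families_def pairwise_def disjnt_iff)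

lemma pair_edges: "p \<in> F \<Longrightarrow> e \<in> p \<Longrightarrow> e \<in> edges G"
  using family_pair by (auto elim: edge_pairsE)

lemma family_pair_partner:
  assumes "p \<in> F" "e \<in> p"
  obtains f where "p = {e, f}" "e \<noteq> f" "e \<inter> f = {}"
proof -
  obtain g h where "p = {g, h}" "g \<noteq> h" "g \<inter> h = {}"
    using family_pair[OF assms(1)] by (elim edge_pairsE)
  moreover from this have "e = g \<or> e = h"
    using assms(2) by simp
  ultimately show ?thesis
    using that[of g] that[of h] by (metis Int_commute insert_commute)
qed

lemma replace_family:
  assumes "R \<subseteq> F" "R' \<subseteq> edge_pairs G" "pairwise disjnt R'" "\<Union>R' \<subseteq> \<Union>R \<union> uncovered"
  shows "(F - R) \<union> R' \<in> edge_disjoint_families G" "(F - R) \<inter> R' = {}"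
proof -
  have disj: "disjnt p q" if "p \<in> F - R" "q \<in> R'" for p q
  proof -
    have "e \<notin> q" if e: "e \<in> p" for e
    proof
      assume "e \<in> q"
      then have "e \<in> \<Union>R \<union> uncovered"
        using \<open>q \<in> R'\<close> assms(4) by blast
      then obtain r where "r \<in> R" "e \<in> r"
        using e \<open>p \<in> F - R\<close> by blast
      then show False
        using family_unique[of r p e] e \<open>p \<in> F - R\<close> assms(1) by blast
    qed
    then show ?thesis by (auto simp: disjnt_iff)
  qed
  show "(F - R) \<union> R' \<in> edge_disjoint_families G"
    using family assms(2,3) disj
    unfolding edge_disjoint_families_def pairwise_def by (auto simp: disjnt_sym)
  have "p \<noteq> {}" if "p \<in> R'" for p
    using that assms(2) by (auto elim!: edge_pairsE)
  then show "(F - R) \<inter> R' = {}"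
    using disj by (metis disjoint_iff disjnt_self_iff_empty)
qed

text \<open>Otherwise the exchanged family would be larger than \<open>F\<close>. All uses of
  maximality below except \<open>maximum_family_swap\<close> go through this inequality.\<close>

lemma card_replacement_le:
  assumes "R \<subseteq> F" "R' \<subseteq> edge_pairs G" "pairwise disjnt R'" "\<Union>R' \<subseteq> \<Union>R \<union> uncovered" "finite R'"
  shows "card R' \<le> card R"
proof -
  have fin: "finite R"
    using assms(1) finite_family finite_subset by blast
  have "card (F - R) + card R' = card ((F - R) \<union> R')"
    using replace_family(2)[OF assms(1-4)] finite_family assms(5)
    by (simp add: card_Un_disjoint)
  also have "\<dots> \<le> card F"
    using maximum replace_family(1)[OF assms(1-4)] by blast
  finally show ?thesis
    using card_Diff_subset[OF fin assms(1)] card_mono[OF finite_family assms(1)] by linarith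
qed

text \<open>Two disjoint uncovered edges could be added to \<open>F\<close> as a new pair, with
  nothing removed.\<close>

lemma uncovered_intersecting:
  assumes "a \<in> uncovered" "b \<in> uncovered"
  shows "a \<inter> b \<noteq> {}"
proof (cases "a = b")
  case True
  then show ?thesis
    using assms edge_not_empty[OF simple] by auto
next
  case False
  show ?thesis
  proof
    assume "a \<inter> b = {}"
    then have "card {{a, b}} \<le> card ({} :: 'a set set set)"
      using False assms by (intro card_replacement_le) (auto intro: edge_pairsI)
    then show False by simp
  qed
qed

text \<open>If both intersections were empty, the single pair \<open>{e, f}\<close> could be
  replaced by the two pairs \<open>{a, e}\<close> and \<open>{b, f}\<close>.\<close>

lemma no_exchange:
  assumes "{e, f} \<in> F" "e \<noteq> f" "a \<in> uncovered" "b \<in> uncovered" "a \<noteq> b"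
  shows "a \<inter> e \<noteq> {} \<or> b \<inter> f \<noteq> {}"
proof (rule ccontr)
  assume "\<not> (a \<inter> e \<noteq> {} \<or> b \<inter> f \<noteq> {})"
  then have disj: "a \<inter> e = {}" "b \<inter> f = {}" by auto
  have ef: "e \<in> edges G" "f \<in> edges G"
    using pair_edges[OF assms(1)] by auto
  have ne: "a \<noteq> e" "b \<noteq> f" "a \<noteq> f" "b \<noteq> e"
    using assms by auto
  then have "card {{a, e}, {b, f}} \<le> card {{e, f}}"
    using assms ef disj
    by (intro card_replacement_le) (auto intro: edge_pairsI simp: pairwise_def disjnt_iff)
  moreover have "{a, e} \<noteq> {b, f}"
    using assms(2,5) ne by (auto simp: doubleton_eq_iff)
  ultimately show False by simp
qed

section \<open>Uncovered stars and triangles\<close>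

lemma star_pair:
  assumes "{v, x} \<in> uncovered" "{v, y} \<in> uncovered" "x \<noteq> y" "p \<in> F" "v \<notin> \<Union>p"
  shows "{x, y} \<in> p"
proof -
  obtain e f where p: "p = {e, f}" and ef: "e \<noteq> f" "e \<inter> f = {}" "e \<in> edges G" "f \<in> edges G"
    using family_pair[OF assms(4)] by (elim edge_pairsE)
  have v: "v \<notin> e" "v \<notin> f"
    using assms(5) p by auto
  have "{v, x} \<noteq> {v, y}"
    using assms(3) by (auto simp: doubleton_eq_iff)
  \<comment> \<open>The two uncovered edges can be matched with \<open>e\<close> and
    \<open>f\<close> in two ways, and neither exchange is possible. As \<open>e\<close> and
    \<open>f\<close> are disjoint, the two disjunctions together force \<open>x\<close> and
    \<open>y\<close> into the same edge.\<close>
  then have "x \<in> e \<or> y \<in> f" "y \<in> e \<or> x \<in> f"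
    using no_exchange[of e f "{v, x}" "{v, y}"] no_exchange[of e f "{v, y}" "{v, x}"]
      assms(1,2,4) ef(1) v unfolding p by auto
  then have "{x, y} \<subseteq> e \<or> {x, y} \<subseteq> f"
    using ef(2) by auto
  then have "e = {x, y} \<or> f = {x, y}"
    using edge_eq_doubleton[OF simple] ef(3,4) assms(3) by blast
  then show ?thesis
    using p by auto
qed

text \<open>Counterpart of \<open>card_edge_disjoint_family_le_avoiding\<close>: every edge avoiding
  \<open>v\<close> is covered, and a pair that meets \<open>v\<close> contains at most one such
  edge, so sending an edge to its pair is injective.\<close>

lemma card_avoiding_le:
  assumes "\<And>a. a \<in> uncovered \<Longrightarrow> v \<in> a" "\<And>p. p \<in> F \<Longrightarrow> v \<in> \<Union>p"
  shows "card {e \<in> edges G. v \<notin> e} \<le> card F"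
proof -
  have "\<exists>p. p \<in> F \<and> e \<in> p" if "e \<in> edges G" "v \<notin> e" for e
    using assms(1) that by blast
  then obtain c where c: "\<And>e. e \<in> edges G \<Longrightarrow> v \<notin> e \<Longrightarrow> c e \<in> F \<and> e \<in> c e"
    by metis
  have "inj_on c {e \<in> edges G. v \<notin> e}"
  proof (rule inj_onI, clarify)
    fix e f
    assume e: "e \<in> edges G" "v \<notin> e" and f: "f \<in> edges G" "v \<notin> f" and eq: "c e = c f"
    have "c e \<in> edge_pairs G" "e \<in> c e" "f \<in> c e" "v \<in> \<Union>(c e)"
      using c[OF e] c[OF f] eq family_pair assms(2) by auto
    then show "e = f"
      using e(2) f(2) by (auto elim!: edge_pairsE)
  qed
  then show ?thesis
    using c finite_family by (intro card_inj_on_le[of c]) auto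
qed

text \<open>Pigeonhole: three vertices are covered by two edges, so one edge contains two of
  them.\<close>

lemma pair_covering_three:
  assumes "p \<in> F" "v \<in> \<Union>p" "x \<in> \<Union>p" "y \<in> \<Union>p" "v \<noteq> x" "v \<noteq> y" "x \<noteq> y"
  shows "{v, x} \<in> p \<or> {v, y} \<in> p \<or> {x, y} \<in> p"
proof -
  obtain e f where p: "p = {e, f}" and ef: "e \<in> edges G" "f \<in> edges G"
    using family_pair[OF assms(1)] by (elim edge_pairsE)
  have "\<exists>g\<in>p. {v, x} \<subseteq> g \<or> {v, y} \<subseteq> g \<or> {x, y} \<subseteq> g"
    using assms(2-4) unfolding p by auto
  then obtain g where g: "g \<in> p" "{v, x} \<subseteq> g \<or> {v, y} \<subseteq> g \<or> {x, y} \<subseteq> g"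
    by blast
  then have "g = {v, x} \<or> g = {v, y} \<or> g = {x, y}"
    using edge_eq_doubleton[OF simple pair_edges[OF assms(1) g(1)]] assms(5-7) by blast
  then show ?thesis
    using g(1) by blast
qed

lemma triangle_family_empty:
  assumes "{v, x} \<in> uncovered" "{v, y} \<in> uncovered" "{x, y} \<in> uncovered"
    "v \<noteq> x" "v \<noteq> y" "x \<noteq> y"
  shows "F = {}"
proof (rule ccontr)
  assume "F \<noteq> {}"
  then obtain p where p: "p \<in> F" by blast
  \<comment> \<open>A pair missing a vertex of the triangle would contain the opposite edge, so it meets all three.\<close>
  have "v \<in> \<Union>p" "x \<in> \<Union>p" "y \<in> \<Union>p"
    using star_pair[of v x y p] star_pair[of x v y p] star_pair[of y v x p] assms p
    by (auto simp: insert_commute)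
  then have "{v, x} \<in> p \<or> {v, y} \<in> p \<or> {x, y} \<in> p"
    using pair_covering_three p assms(4-6) by blast
  then show False
    using assms(1-3) p by blast
qed

text \<open>The size is unchanged, so the new family is again maximum. Concluding the locale
  predicate makes the exchange lemmas available for the new family, in which the former partner of
  \<open>f\<close> is uncovered.\<close>

lemma maximum_family_swap:
  assumes "p \<in> F" "f \<in> p" "a \<in> uncovered" "a \<inter> f = {}"
  shows "maximum_family G (F - {p} \<union> {{a, f}})"
proof
  have f: "f \<in> edges G" "a \<noteq> f"
    using pair_edges[OF assms(1,2)] assms(1-3) by blast+
  note new = replace_family[of "{p}" "{{a, f}}"]
  have prems: "{p} \<subseteq> F" "{{a, f}} \<subseteq> edge_pairs G" "pairwise disjnt {{a, f}}"
    "\<Union>{{a, f}} \<subseteq> \<Union>{p} \<union> uncovered"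
    using assms f by (auto intro: edge_pairsI)
  show "F - {p} \<union> {{a, f}} \<in> edge_disjoint_families G"
    using new(1)[OF prems] .
  have "card (F - {p} \<union> {{a, f}}) = card F"
    using new(2)[OF prems] finite_family assms(1)
    by (simp add: card_gt_0_iff) (metis Suc_pred card_gt_0_iff empty_iff)
  then show "card F' \<le> card (F - {p} \<union> {{a, f}})" if "F' \<in> edge_disjoint_families G" for F'
    using maximum[OF that] by simp
qed (rule simple)

lemma exceptional_star:
  assumes "{v, x} \<in> uncovered" "{v, y} \<in> uncovered" "x \<noteq> y" "v \<noteq> x" "v \<noteq> y"
    and p: "p \<in> F" "v \<notin> \<Union>p"
    and star: "\<And>a. a \<in> uncovered \<Longrightarrow> v \<in> a"
  shows "\<exists>f. edges G = {{v, x}, {v, y}, {x, y}, f} \<and> f \<inter> {v, x, y} = {}"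
proof -
  have xy: "{x, y} \<in> p"
    using star_pair assms by blast
  obtain f where f: "p = {{x, y}, f}" "{x, y} \<noteq> f" "{x, y} \<inter> f = {}"
    using family_pair_partner[OF p(1) xy] .
  have fp: "f \<in> p"
    using f(1) by simp
  have vf: "v \<notin> f"
    using p(2) f(1) by auto
  \<comment> \<open>A third uncovered edge \<open>{v, z}\<close> would give
    \<open>{x, z} \<in> p\<close> by \<open>star_pair\<close>. But \<open>x\<close> lies in only one
    edge of \<open>p\<close>, namely \<open>{x, y}\<close>, so \<open>z = y\<close>.\<close>
  have only: "uncovered = {{v, x}, {v, y}}"
  proof (rule ccontr)
    assume "uncovered \<noteq> {{v, x}, {v, y}}"
    then obtain a where a: "a \<in> uncovered" "a \<noteq> {v, x}" "a \<noteq> {v, y}"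
      using assms(1,2) by blast
    obtain z where z: "a = {v, z}" "z \<noteq> x" "z \<noteq> y"
      using star[OF a(1)] a by (auto elim!: simple_graph_edgeE[OF simple])
    then have "{x, z} \<in> p"
      using star_pair[of v x z p] assms(1) a(1) p by auto
    then show False
      using f z by (auto simp: doubleton_eq_iff)
  qed
  have "F = {p}"
  proof (rule ccontr)
    assume "F \<noteq> {p}"
    then obtain q where q: "q \<in> F" "q \<noteq> p"
      using p(1) by blast
    have disj: "a \<notin> q" if "a \<in> {{v, x}, {v, y}, {x, y}}" for a
      using that assms(1,2) q xy p(1) family_unique[of p q "{x, y}"] by auto
    have "v \<in> \<Union>q"
      using star_pair[OF assms(1-3) q(1)] disj by blast
    \<comment> \<open>Trading \<open>{x, y}\<close> for \<open>{v, y}\<close> uncovers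
      \<open>{x, y}\<close>, so the uncovered edges contain a star centred at \<open>x\<close>;
      trading it for \<open>{v, x}\<close> gives one centred at \<open>y\<close>. Since
      \<open>q\<close> survives both swaps and contains no edge of the triangle,
      \<open>star_pair\<close> makes it meet \<open>x\<close> and \<open>y\<close> as well as
      \<open>v\<close>.\<close>
    interpret swap_y: maximum_family G "F - {p} \<union> {{{v, y}, f}}"
      by (rule maximum_family_swap[OF p(1) fp assms(2)]) (use f(3) vf in auto)
    interpret swap_x: maximum_family G "F - {p} \<union> {{{v, x}, f}}"
      by (rule maximum_family_swap[OF p(1) fp assms(1)]) (use f(3) vf in auto)
    have xy_free: "{x, y} \<notin> \<Union>(F - {p})"
      using family_unique[OF p(1) _ xy] by blast
    have xyG: "{x, y} \<in> edges G"
      using pair_edges[OF p(1) xy] .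
    have neq: "{v, x} \<noteq> {v, y}" "{x, y} \<noteq> {v, y}" "{x, y} \<noteq> {v, x}" "f \<noteq> {v, x}" "f \<noteq> {v, y}"
      using assms(3-5) vf by (auto simp: doubleton_eq_iff)
    have "{x, v} \<in> swap_y.uncovered" "{x, y} \<in> swap_y.uncovered"
      using assms(1) xyG xy_free neq f(2) by (auto simp: insert_commute)
    from swap_y.star_pair[OF this assms(5)] have "x \<in> \<Union>q"
      using q disj by blast
    have "{y, v} \<in> swap_x.uncovered" "{y, x} \<in> swap_x.uncovered"
      using assms(2) xyG xy_free neq f(2) by (auto simp: insert_commute)
    from swap_x.star_pair[OF this assms(4)] have "y \<in> \<Union>q"
      using q disj by blast
    have "{v, x} \<in> q \<or> {v, y} \<in> q \<or> {x, y} \<in> q"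
      using pair_covering_three q(1) \<open>v \<in> \<Union>q\<close> \<open>x \<in> \<Union>q\<close> \<open>y \<in> \<Union>q\<close> assms(3-5) by blast
    then show False
      using disj by auto
  qed
  have "edges G = uncovered \<union> p"
    using \<open>F = {p}\<close> pair_edges[OF p(1)] by auto
  then have "edges G = {{v, x}, {v, y}, {x, y}, f}"
    unfolding only f(1) by auto
  then show ?thesis
    using f(3) vf by blast
qed

section \<open>The lower bound and its exceptions\<close>

theorem lower_bound_or_exceptional:
  obtains
    (half) "card (edges G) div 2 \<le> card F"
  | (degree) v where "v \<in> verts G" "card (edges G) - degree G v \<le> card F"
  | (triangle) v x y where "v \<noteq> x" "v \<noteq> y" "x \<noteq> y" "edges G = {{v, x}, {v, y}, {x, y}}"
  | (triangle_edge) v x y f where "v \<noteq> x" "v \<noteq> y" "x \<noteq> y"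
      "edges G = {{v, x}, {v, y}, {x, y}, f}" "f \<inter> {v, x, y} = {}"
\<comment> \<open>The number of uncovered edges is \<open>card (edges G) - 2 * card F\<close>; if it
  is at most 1, then \<open>F\<close> reaches the rounded-down half.\<close>
proof (cases "card uncovered \<le> 1")
  case True
  have "\<Union>F \<subseteq> edges G"
    using pair_edges by blast
  then have "card uncovered = card (edges G) - 2 * card F"
    using card_Union_edge_disjoint_family[OF simple family] finite_edges[OF simple]
    by (simp add: card_Diff_subset finite_subset)
  then show ?thesis
    using True half by linarith
next
  case False
  then obtain a b where ab: "a \<in> uncovered" "b \<in> uncovered" "a \<noteq> b"
    by (metis card_le_Suc0_iff_eq One_nat_def card.infinite nat_le_linear not_one_le_zero)
  obtain v where v: "v \<in> a" "v \<in> b"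
    using uncovered_intersecting[OF ab(1,2)] by blast
  obtain x where x: "a = {v, x}" "v \<noteq> x"
    using ab(1) v(1) by (auto elim!: simple_graph_edgeE[OF simple])
  obtain y where y: "b = {v, y}" "v \<noteq> y"
    using ab(2) v(2) by (auto elim!: simple_graph_edgeE[OF simple])
  have xy: "x \<noteq> y"
    using ab(3) x y by auto
  \<comment> \<open>An uncovered edge meets both \<open>{v, x}\<close> and \<open>{v, y}\<close>; if
    it misses \<open>v\<close>, it must contain \<open>x\<close> and \<open>y\<close>.\<close>
  have other: "v \<in> c \<or> c = {x, y}" if "c \<in> uncovered" for c
    using uncovered_intersecting[OF that ab(1)] uncovered_intersecting[OF that ab(2)] that xy
    unfolding x y by (auto elim!: simple_graph_edgeE[OF simple])
  show ?thesis
  proof (cases "{x, y} \<in> uncovered")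
    case True
    have empty: "F = {}"
      using triangle_family_empty[of v x y] True ab x y xy by auto
    \<comment> \<open>With \<open>F\<close> empty every edge is uncovered. One through
      \<open>v\<close> must also meet \<open>{x, y}\<close>, so its other end is \<open>x\<close> or
      \<open>y\<close>.\<close>
    have "c \<in> {{v, x}, {v, y}, {x, y}}" if "c \<in> edges G" for c
    proof -
      have "c \<in> uncovered"
        using that empty by simp
      then have "v \<in> c \<or> c = {x, y}" "c \<inter> {x, y} \<noteq> {}"
        using other uncovered_intersecting True by auto
      then show ?thesis
        using that x(2) y(2) by (auto elim!: simple_graph_edgeE[OF simple])
    qed
    then have "edges G = {{v, x}, {v, y}, {x, y}}"
      using True ab x y by auto
    then show ?thesis
      using triangle[OF x(2) y(2) xy] by blast
  next
    case False
    then have star: "v \<in> c" if "c \<in> uncovered" for c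
      using other that by blast
    show ?thesis
    proof (cases "\<forall>p\<in>F. v \<in> \<Union>p")
      case True
      then have "card {e \<in> edges G. v \<notin> e} \<le> card F"
        using card_avoiding_le star by blast
      moreover have "v \<in> verts G"
        using ab(1) v(1) simple by (auto simp: simple_graph_def)
      ultimately show ?thesis
        using degree[of v] card_edges_split[OF simple, of v] by auto
    next
      case False
      then obtain p where "p \<in> F" "v \<notin> \<Union>p" by blast
      then have "\<exists>f. edges G = {{v, x}, {v, y}, {x, y}, f} \<and> f \<inter> {v, x, y} = {}"
        using exceptional_star[OF _ _ xy x(2) y(2)] ab star unfolding x y by blast
      then show ?thesis
        using triangle_edge[OF x(2) y(2) xy] by blast
    qed
  qed
qed

end

section \<open>Identifying the exceptional graphs up to isomorphism\<close>

lemma graph_isoI: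
  assumes "simple_graph G" "bij_betw f (verts G) (verts H)" "edges H = (`) f ` edges G"
  shows "graph_iso G H"
  unfolding graph_iso_def
proof (intro exI conjI ballI)
  fix u v
  assume uv: "u \<in> verts G" "v \<in> verts G"
  \<comment> \<open>Taking images under \<open>f\<close> is injective on sets of vertices, so the
    image of \<open>{u, v}\<close> is an edge of \<open>H\<close> only if \<open>{u, v}\<close>
    itself is an edge of \<open>G\<close>.\<close>
  have inj: "inj_on ((`) f) (Pow (verts G))"
    using assms(2) by (simp add: bij_betw_def inj_on_image_Pow)
  have sub: "edges G \<subseteq> Pow (verts G)"
    using assms(1) by (auto simp: simple_graph_def)
  have "{f u, f v} \<in> edges H \<longleftrightarrow> f ` {u, v} \<in> (`) f ` edges G"
    by (simp add: assms(3))
  also have "\<dots> \<longleftrightarrow> {u, v} \<in> edges G"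
    using inj_on_image_mem_iff[OF inj _ sub, of "{u, v}"] uv by simp
  finally show "{u, v} \<in> edges G \<longleftrightarrow> {f u, f v} \<in> edges H" by simp
qed (rule assms(2))

lemma edges_complete_graph_3: "edges (complete_graph 3) = {{0, 1}, {0, 2}, {1, 2}}"
proof (intro equalityI subsetI)
  fix e
  assume "e \<in> edges (complete_graph 3)"
  then obtain a b where "e = {a, b}" "a \<noteq> b" "a < 3" "b < 3"
    by (auto simp: complete_graph_def card_2_iff)
  moreover from this have "a \<in> {0, 1, 2}" "b \<in> {0, 1, 2}" by auto
  ultimately show "e \<in> {{0, 1}, {0, 2}, {1, 2}}"
    by (elim insertE emptyE) (simp_all add: insert_commute)
qed (auto simp: complete_graph_def)

lemma edges_complete_graph_2: "edges (complete_graph 2) = {{0, 1}}"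
proof (intro equalityI subsetI)
  fix e
  assume "e \<in> edges (complete_graph 2)"
  then obtain a b where "e = {a, b}" "a \<noteq> b" "a < 2" "b < 2"
    by (auto simp: complete_graph_def card_2_iff)
  moreover from this have "a \<in> {0, 1}" "b \<in> {0, 1}" by auto
  ultimately show "e \<in> {{0, 1}}"
    by (elim insertE emptyE) (simp_all add: insert_commute)
qed (auto simp: complete_graph_def)

lemma graph_iso_triangle:
  assumes "simple_graph G" "v \<noteq> x" "v \<noteq> y" "x \<noteq> y" "edges G = {{v, x}, {v, y}, {x, y}}"
  shows "order G \<ge> 3"
    "graph_iso G (disjoint_union (complete_graph 3) (edgeless_graph (order G - 3)))"
proof -
  have fin: "finite (verts G)"
    using assms(1) by (simp add: simple_graph_def)
  have T: "{v, x, y} \<subseteq> verts G" "card {v, x, y} = 3"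
    using assms by (auto simp: simple_graph_def)
  show "order G \<ge> 3"
    unfolding order_def using card_mono[OF fin T(1)] T(2) by simp
  \<comment> \<open>The vertices off the triangle are isolated, so any bijection \<open>g\<close>
    onto the edgeless part will do.\<close>
  have "card (verts G - {v, x, y}) = order G - 3"
    unfolding order_def using card_Diff_subset[OF _ T(1)] T(2) by simp
  then obtain g where g: "bij_betw g (verts G - {v, x, y}) {..<order G - 3}"
    using fin by (metis finite_Diff finite_lessThan finite_same_card_bij card_lessThan)
  define f where "f u = (if u = v then Inl 0 else if u = x then Inl 1 else if u = y then Inl 2
    else Inr (g u) :: nat + nat)" for u
  have "bij_betw f {v, x, y} (Inl ` {..<3})"
  proof -
    have "{..<3} = {0, 1, 2 :: nat}" by auto
    then show ?thesis
      using assms(2-4) by (auto simp: f_def bij_betw_def inj_on_def)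
  qed
  moreover have "bij_betw f (verts G - {v, x, y}) (Inr ` {..<order G - 3})"
  proof -
    have "bij_betw (Inr \<circ> g) (verts G - {v, x, y}) (Inr ` {..<order G - 3} :: (nat + nat) set)"
      using g by (rule bij_betw_trans) (simp add: bij_betw_def)
    then show ?thesis
      by (rule bij_betw_cong[THEN iffD1, rotated]) (auto simp: f_def)
  qed
  ultimately have "bij_betw f ({v, x, y} \<union> (verts G - {v, x, y}))
      (Inl ` {..<3} \<union> Inr ` {..<order G - 3})"
    by (rule bij_betw_combine) auto
  moreover have "{v, x, y} \<union> (verts G - {v, x, y}) = verts G"
    using T(1) by blast
  ultimately have "bij_betw f (verts G) ({..<3} <+> {..<order G - 3})"
    by (simp only: Plus_def)
  moreover have "f v = Inl 0" "f x = Inl 1" "f y = Inl 2"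
    using assms(2-4) by (simp_all add: f_def)
  then have "(`) f ` edges G = (`) Inl ` edges (complete_graph 3)"
    by (simp add: edges_complete_graph_3 assms(5))
  ultimately show "graph_iso G (disjoint_union (complete_graph 3) (edgeless_graph (order G - 3)))"
    by (intro graph_isoI[OF assms(1), where f = f])
      (simp_all add: disjoint_union_def complete_graph_def edgeless_graph_def)
qed

lemma graph_iso_triangle_edge:
  assumes "simple_graph G" "v \<noteq> x" "v \<noteq> y" "x \<noteq> y"
    "edges G = {{v, x}, {v, y}, {x, y}, e}" "e \<inter> {v, x, y} = {}"
  shows "order G \<ge> 5"
    "graph_iso G (disjoint_union (complete_graph 3)
       (disjoint_union (complete_graph 2) (edgeless_graph (order G - 5))))"
proof -
  have fin: "finite (verts G)"
    using assms(1) by (simp add: simple_graph_def)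
  obtain z w where e: "e = {z, w}" "z \<noteq> w"
    by (rule simple_graph_edgeE[OF assms(1), of e]) (simp add: assms(5))
  have ne: "z \<noteq> v" "z \<noteq> x" "z \<noteq> y" "w \<noteq> v" "w \<noteq> x" "w \<noteq> y"
    using assms(6) e by auto
  let ?T = "{v, x, y, z, w}"
  have T: "?T \<subseteq> verts G" "card ?T = 5"
    using assms e ne by (auto simp: simple_graph_def)
  show "order G \<ge> 5"
    unfolding order_def using card_mono[OF fin T(1)] T(2) by simp
  have "card (verts G - ?T) = order G - 5"
    unfolding order_def using card_Diff_subset[OF _ T(1)] T(2) by simp
  then obtain g where g: "bij_betw g (verts G - ?T) {..<order G - 5}"
    using fin by (metis finite_Diff finite_lessThan finite_same_card_bij card_lessThan)
  \<comment> \<open>The nesting of \<open>Inl\<close> and \<open>Inr\<close> follows the iterated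
    disjoint union: triangle, then the separate edge, then the isolated vertices.\<close>
  define f where "f u = (if u = v then Inl 0 else if u = x then Inl 1 else if u = y then Inl 2
    else if u = z then Inr (Inl 0) else if u = w then Inr (Inl 1)
    else Inr (Inr (g u)) :: nat + nat + nat)" for u
  have "bij_betw f ?T (Inl ` {..<3} \<union> Inr ` Inl ` {..<2})"
  proof -
    have "{..<3} = {0, 1, 2 :: nat}" "{..<2} = {0, 1 :: nat}" by auto
    then show ?thesis
      using assms(2-4) e(2) ne by (auto simp: f_def bij_betw_def inj_on_def)
  qed
  moreover have "bij_betw f (verts G - ?T) (Inr ` Inr ` {..<order G - 5})"
  proof -
    have "bij_betw ((Inr \<circ> Inr) \<circ> g) (verts G - ?T)
        ((Inr \<circ> Inr) ` {..<order G - 5} :: (nat + nat + nat) set)"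
      using g by (rule bij_betw_trans) (simp add: bij_betw_def inj_on_def)
    then show ?thesis
      unfolding image_comp
      by (rule bij_betw_cong[THEN iffD1, rotated]) (auto simp: f_def)
  qed
  ultimately have "bij_betw f (?T \<union> (verts G - ?T))
      ((Inl ` {..<3} \<union> Inr ` Inl ` {..<2}) \<union> Inr ` Inr ` {..<order G - 5})"
    by (rule bij_betw_combine) auto
  moreover have "?T \<union> (verts G - ?T) = verts G"
    using T(1) by blast
  ultimately have "bij_betw f (verts G) ({..<3} <+> ({..<2} <+> {..<order G - 5}))"
    by (simp only: Plus_def image_Un Un_assoc)
  moreover have "f v = Inl 0" "f x = Inl 1" "f y = Inl 2" "f z = Inr (Inl 0)" "f w = Inr (Inl 1)"
    using assms(2-4) e(2) ne by (simp_all add: f_def)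
  then have "(`) f ` edges G = (`) Inl ` edges (complete_graph 3) \<union>
      (`) Inr ` (`) Inl ` edges (complete_graph 2)"
    by (simp add: edges_complete_graph_3 edges_complete_graph_2 assms(5) e(1) insert_commute)
  ultimately show "graph_iso G (disjoint_union (complete_graph 3)
       (disjoint_union (complete_graph 2) (edgeless_graph (order G - 5))))"
    by (intro graph_isoI[OF assms(1), where f = f])
      (simp_all add: disjoint_union_def complete_graph_def edgeless_graph_def)
qed

section \<open>Combining the bounds\<close>

theorem theorem8:
  fixes G :: "'a ugraph" and n :: nat
  assumes "simple_graph G"
    and "order G = n"
    and "n \<ge> 3 \<Longrightarrow>
           \<not> graph_iso G (disjoint_union (complete_graph 3) (edgeless_graph (n - 3)))"
    and "n \<ge> 5 \<Longrightarrow>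
           \<not> graph_iso G (disjoint_union (complete_graph 3)
                (disjoint_union (complete_graph 2) (edgeless_graph (n - 5))))"
  shows "(card (edges G) \<ge> 2 * max_degree G \<longrightarrow>
            max_edge_disjoint_pairs G = card (edges G) div 2) \<and>
         (card (edges G) < 2 * max_degree G \<longrightarrow>
            int (max_edge_disjoint_pairs G) = int (card (edges G)) - int (max_degree G))"
proof -
  let ?m = "card (edges G)" and ?D = "max_degree G"
  have fin: "finite (card ` edge_disjoint_families G)"
    using finite_edge_disjoint_families[OF assms(1)] by simp
  have "max_edge_disjoint_pairs G \<in> card ` edge_disjoint_families G"
    unfolding max_edge_disjoint_pairs_def
    using empty_in_edge_disjoint_families fin by (intro Max_in) auto
  then obtain F where F: "F \<in> edge_disjoint_families G" "max_edge_disjoint_pairs G = card F"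
    by auto
  interpret maximum_family G F
  proof
    show "card F' \<le> card F" if "F' \<in> edge_disjoint_families G" for F'
      using that fin unfolding F(2)[symmetric] max_edge_disjoint_pairs_def by simp
  qed (use assms(1) F in auto)
  have half: "2 * card F \<le> ?m"
    using card_edge_disjoint_family_le_half[OF assms(1) F(1)] .
  have deg: "card F + ?D \<le> ?m"
  \<comment> \<open>Without vertices no vertex attains the maximum degree; there
    \<open>max_degree G\<close> is 0 and the bound follows from \<open>half\<close>.\<close>
  proof (cases "verts G = {}")
    case True
    then show ?thesis
      using half by (simp add: max_degree_def)
  next
    case False
    then obtain v where "?D = degree G v"
      using max_degree_attained[OF assms(1)] by blast
    then show ?thesis
      using card_edges_split[OF assms(1), of v]
        card_edge_disjoint_family_le_avoiding[OF assms(1) F(1), of v] by simp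
  qed
  have "?m div 2 \<le> card F \<or> ?m - ?D \<le> card F"
  proof (cases rule: lower_bound_or_exceptional)
    case half
    then show ?thesis by simp
  next
    \<comment> \<open>The vertex \<open>v\<close> need not have maximum degree: a smaller degree
      only strengthens the bound.\<close>
    case (degree v)
    then show ?thesis
      using degree_le_max_degree[OF assms(1), of v] by linarith
  next
    case (triangle v x y)
    then show ?thesis
      using graph_iso_triangle[OF assms(1) triangle] assms(2,3) by simp
  next
    case (triangle_edge v x y f)
    then show ?thesis
      using graph_iso_triangle_edge[OF assms(1) triangle_edge] assms(2,4) by simp
  qed
  \<comment> \<open>Together with \<open>half\<close> and \<open>deg\<close>, the disjunction says
    that \<open>card F\<close> is the minimum of \<open>?m div 2\<close> and \<open>?m - ?D\<close>.
    Comparing \<open>?m\<close> with \<open>2 * ?D\<close> decides which of the two is smaller, and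
    \<open>deg\<close> rules out truncated subtraction.\<close>
  then show ?thesis
    unfolding F(2) using half deg by auto
qed

end
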